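(* Let $\mathcal{X}\subseteq\mathbb{R}^n$ and $\mathcal{E}\subseteq\mathbb{R}^n$ contain the origin, let $\mathcal{Y}\subseteq\mathbb{R}^m$, and let $f:\mathcal{X}\to\mathcal{X}$ and $h:\mathcal{X}\to\mathcal{Y}$ be sufficiently smooth. Let $W_{ay}\in\mathbb{R}^{k\times m}$, $W_{ax}\in\mathbb{R}^{k\times n}$, $W_{xa}\in\mathbb{R}^{n\times k}$ be matrices and let $\sigma:\mathbb{R}\to\mathbb{R}$ be an activation function, applied componentwise to vectors in $\mathbb{R}^k$. Define $$g(e,x)=f(x)-W_{xa}\,\sigma\big(W_{ay}\,h(f(x))+W_{ax}\,x-W_{ax}\,e\big),$$ and assume $g(e,x)\in\mathcal{E}$ for all $(e,x)\in\mathcal{E}\times\mathcal{X}$. Consider the discrete-time system $$x^{(t+1)}=f(x^{(t)}),\qquad x^{(0)}=\xi\in\mathcal{X}, \qquad (\mathrm{S})$$ and the error system $$e^{(t+1)}=g(e^{(t)},x^{(t)}),\qquad e^{(0)}=\eta\in\mathcal{E}. \qquad (\mathrm{E})$$ If the error system $(\mathrm{E})$, with $x^{(t)}$ regarded as the input, is input-to-state stable, and the origin of $(\mathrm{S})$ is globally asymptotically stable, then the origin of the cascade system formed by $(\mathrm{S})$ and $(\mathrm{E})$, that is, the system $$\big(x^{(t+1)},e^{(t+1)}\big)=\big(f(x^{(t)}),\,g(e^{(t)},x^{(t)})\big),\qquad (x^{(0)},e^{(0)})=(\xi,\eta)\in\mathcal{X}\times\mathcal{E},$$ is globally asymptotically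 stable.
   Context: Time $t$ ranges over the nonnegative integers $\mathbf{Z}_+$, and $\|\cdot\|$ denotes the Euclidean norm of a vector. Origin of the error system: the noise-free system is $x^{(t+1)}=f(x^{(t)})$, $y^{(t+1)}=h(x^{(t+1)})$. The (bias-free) Jordan recurrent neural network estimator is $\hat{x}^{(t+1)}=W_{xa}\,\sigma(W_{ay}y^{(t+1)}+W_{ax}\hat{x}^{(t)})$. The error $e^{(t)}=x^{(t)}-\hat{x}^{(t)}$ then satisfies $e^{(t+1)}=g(e^{(t)},x^{(t)})$ with $g$ as in the claim. $\mathcal{K}$-function: a continuous function $\alpha:\mathbb{R}_{\ge 0}\to\mathbb{R}_{\ge 0}$ that is strictly increasing with $\alpha(0)=0$. $\mathcal{KL}$-function: a continuous function $\beta:\mathbb{R}_{\ge 0}\times\mathbb{R}_{\ge 0}\to\mathbb{R}_{\ge 0}$ such that for each $t$, $\beta(\cdot,t)$ is a $\mathcal{K}$-function, and for each $r$, $\beta(r,\cdot)$ is decreasing and $\beta(r,t)\to 0$ as $t\to\infty$. Global asymptotic stability: for a system $z^{(t+1)}=F(z^{(t)})$ with state set $\mathcal{Z}$ containing the origin, write $z^{(t)}(\zeta)$ for the solution with $z^{(0)}=\zeta\in\mathcal{Z}$. The origin is globally asymptotically stable if (i) for each $\varepsilon>0$ there is $\delta>0$ such that $\|\zeta\|<\delta$ implies $\|z^{(t)}(\zeta)\|<\varepsilon$ for all $t\ge 0$, and $\lim_{t\to\infty}z^{(t)}(\zeta)=0$; and (ii) there exists a $\mathcal{KL}$-function $\beta$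 such that $\|z^{(t)}(\zeta)\|\le\beta(\|\zeta\|,t)$ for all $\zeta\in\mathcal{Z}$ and all $t\in\mathbf{Z}_+$. For $(\mathrm{S})$, $\mathcal{Z}=\mathcal{X}$; for the cascade system, $\mathcal{Z}=\mathcal{X}\times\mathcal{E}\subseteq\mathbb{R}^{2n}$. Input-to-state stability (ISS) of $(\mathrm{E})$: for $\eta\in\mathcal{E}$ and an input sequence $x=(x^{(t)})_{t\in\mathbf{Z}_+}$ with values in $\mathcal{X}$, let $e^{(t)}(\eta,x)$ denote the solution of $e^{(t+1)}=g(e^{(t)},x^{(t)})$ with $e^{(0)}=\eta$. The system is ISS if there exist a $\mathcal{KL}$-function $\beta$ and a $\mathcal{K}$-function $\gamma$ such that $$\|e^{(t)}(\eta,x)\|\le\beta(\|\eta\|,t)+\gamma\Big(\sup_{s\in\mathbf{Z}_+}\|x^{(s)}\|\Big)$$ for all $t\in\mathbf{Z}_+$, all $\eta\in\mathcal{E}$ and all bounded $\mathcal{X}$-valued input sequences $x$ (arbitrary such sequences, not only solutions of $(\mathrm{S})$). *)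

theory Defs
  imports "HOL-Analysis.Analysis"
begin

text \<open>
  Comparison functions live on the nonnegative reals; their HOL representatives are total on
  the reals, and only the values on \<open>{0..}\<close> are constrained.
\<close>

definition class_K :: "(real \<Rightarrow> real) \<Rightarrow> bool" where
  "class_K \<alpha> \<longleftrightarrow>
     continuous_on {0..} \<alpha> \<and> (\<forall>r\<ge>0. \<alpha> r \<ge> 0) \<and> strict_mono_on {0..} \<alpha> \<and> \<alpha> 0 = 0"

text \<open>
  Since \<open>\<beta> 0 t = 0\<close> for all \<open>t\<close>, ``decreasing'' in the second argument can only mean
  nonincreasing.
\<close>

definition class_KL :: "(real \<Rightarrow> real \<Rightarrow> real) \<Rightarrow> bool" where
  "class_KL \<beta> \<longleftrightarrow>
     continuous_on ({0..} \<times> {0..}) (\<lambda>(r, t). \<beta> r t) \<and>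
     (\<forall>t\<ge>0. class_K (\<lambda>r. \<beta> r t)) \<and>
     (\<forall>r\<ge>0. antimono_on {0..} (\<beta> r) \<and> (\<beta> r \<longlongrightarrow> 0) at_top)"

text \<open>
  The solution of \<open>z (Suc t) = F (z t)\<close>, \<open>z 0 = \<zeta>\<close> is \<open>\<lambda>t. (F ^^ t) \<zeta>\<close>.
  Convergence to the origin is required from every initial state in \<open>Z\<close>.
\<close>

definition globally_asymptotically_stable ::
    "'a::real_normed_vector set \<Rightarrow> ('a \<Rightarrow> 'a) \<Rightarrow> bool" where
  "globally_asymptotically_stable Z F \<longleftrightarrow>
     (\<forall>\<epsilon>>0. \<exists>\<delta>>0. \<forall>\<zeta>\<in>Z. norm \<zeta> < \<delta> \<longrightarrow> (\<forall>t. norm ((F ^^ t) \<zeta>) < \<epsilon>)) \<and>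
     (\<forall>\<zeta>\<in>Z. (\<lambda>t. (F ^^ t) \<zeta>) \<longlonglongrightarrow> 0) \<and>
     (\<exists>\<beta>. class_KL \<beta> \<and> (\<forall>\<zeta>\<in>Z. \<forall>t. norm ((F ^^ t) \<zeta>) \<le> \<beta> (norm \<zeta>) (real t)))"

primrec input_solution :: "('e \<Rightarrow> 'x \<Rightarrow> 'e) \<Rightarrow> 'e \<Rightarrow> (nat \<Rightarrow> 'x) \<Rightarrow> nat \<Rightarrow> 'e" where
  "input_solution G \<eta> x 0 = \<eta>"
| "input_solution G \<eta> x (Suc t) = G (input_solution G \<eta> x t) (x t)"

definition input_to_state_stable ::
    "'e::real_normed_vector set \<Rightarrow> 'x::real_normed_vector set \<Rightarrow> ('e \<Rightarrow> 'x \<Rightarrow> 'e) \<Rightarrow> bool" where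
  "input_to_state_stable E X G \<longleftrightarrow>
     (\<exists>\<beta> \<gamma>. class_KL \<beta> \<and> class_K \<gamma> \<and>
        (\<forall>\<eta>\<in>E. \<forall>x. range x \<subseteq> X \<and> bounded (range x) \<longrightarrow>
           (\<forall>t. norm (input_solution G \<eta> x t)
                  \<le> \<beta> (norm \<eta>) (real t) + \<gamma> (SUP s. norm (x s)))))"

definition cascade :: "('x \<Rightarrow> 'x) \<Rightarrow> ('e \<Rightarrow> 'x \<Rightarrow> 'e) \<Rightarrow> 'x \<times> 'e \<Rightarrow> 'x \<times> 'e" where
  "cascade F G = (\<lambda>(x, e). (F x, G e x))"

definition componentwise :: "(real \<Rightarrow> real) \<Rightarrow> real ^ 'k \<Rightarrow> real ^ 'k" where
  "componentwise \<sigma> v = (\<chi> i. \<sigma> (v $ i))"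

definition error_map ::
    "(real ^ 'n \<Rightarrow> real ^ 'n) \<Rightarrow> (real ^ 'n \<Rightarrow> real ^ 'm) \<Rightarrow> real ^ 'm ^ 'k \<Rightarrow> real ^ 'n ^ 'k
      \<Rightarrow> real ^ 'k ^ 'n \<Rightarrow> (real \<Rightarrow> real) \<Rightarrow> real ^ 'n \<Rightarrow> real ^ 'n \<Rightarrow> real ^ 'n" where
  "error_map f h W\<^sub>a\<^sub>y W\<^sub>a\<^sub>x W\<^sub>x\<^sub>a \<sigma> e x =
     f x - W\<^sub>x\<^sub>a *v componentwise \<sigma> (W\<^sub>a\<^sub>y *v h (f x) + W\<^sub>a\<^sub>x *v x - W\<^sub>a\<^sub>x *v e)"

text \<open>
  \<open>C\<^sup>r\<close> maps between finite-dimensional spaces: on an open set, via directional derivatives of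
  the Frechet derivative; on an arbitrary set, as restrictions of \<open>C\<^sup>r\<close> maps on an open
  neighbourhood.
\<close>

primrec Cr_on_open ::
    "nat \<Rightarrow> 'a::euclidean_space set \<Rightarrow> ('a \<Rightarrow> 'b::euclidean_space) \<Rightarrow> bool" where
  "Cr_on_open 0 U F \<longleftrightarrow> continuous_on U F"
| "Cr_on_open (Suc r) U F \<longleftrightarrow>
     (\<exists>F'. (\<forall>x\<in>U. (F has_derivative F' x) (at x)) \<and> (\<forall>v. Cr_on_open r U (\<lambda>x. F' x v)))"

definition Cr_on ::
    "nat \<Rightarrow> 'a::euclidean_space set \<Rightarrow> ('a \<Rightarrow> 'b::euclidean_space) \<Rightarrow> bool" where
  "Cr_on r S f \<longleftrightarrow>
     (\<exists>U F. open U \<and> S \<subseteq> U \<and> Cr_on_open r U F \<and> (\<forall>x\<in>S. F x = f x))"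

end

theory Submission imports Defs begin

text \<open>
  Restart the error system at time \<open>s = t div 2\<close>. The state bound gives
  \<open>sup {\<parallel>x \<tau>\<parallel> | \<tau> \<ge> s} \<le> \<beta>\<^sub>x \<parallel>\<xi>\<parallel> s\<close>, and \<open>\<parallel>e s\<parallel> \<le> \<beta>\<^sub>e \<parallel>\<eta>\<parallel> 0 + \<gamma> (\<beta>\<^sub>x \<parallel>\<xi>\<parallel> 0) =: \<rho>\<close>, so
  input-to-state stability on the remaining \<open>t - s\<close> steps yields
  \<open>\<parallel>e t\<parallel> \<le> \<beta>\<^sub>e \<rho> (t - s) + \<gamma> (\<beta>\<^sub>x \<parallel>\<xi>\<parallel> s)\<close>. Both \<open>s\<close> and \<open>t - s\<close> tend to infinity with \<open>t\<close>,
  so this is a \<open>KL\<close> bound, from which the other two requirements on the cascade follow.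
\<close>

section \<open>Comparison functions of class \<open>K\<close>\<close>

lemma class_K_mono: "class_K \<alpha> \<Longrightarrow> 0 \<le> r \<Longrightarrow> r \<le> s \<Longrightarrow> \<alpha> r \<le> \<alpha> s"
  unfolding class_K_def strict_mono_on_def
  by (metis atLeast_iff dual_order.trans order_le_imp_less_or_eq order_less_imp_le order_refl)

lemma class_K_nonneg: "class_K \<alpha> \<Longrightarrow> 0 \<le> r \<Longrightarrow> 0 \<le> \<alpha> r"
  by (simp add: class_K_def)

lemma class_K_add:
  assumes "class_K \<alpha>" "class_K \<alpha>'"
  shows "class_K (\<lambda>r. \<alpha> r + \<alpha>' r)"
proof -
  have "continuous_on {0..} (\<lambda>r. \<alpha> r + \<alpha>' r)"
    using assms by (intro continuous_on_add) (simp_all add: class_K_def)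
  moreover have "strict_mono_on {0..} (\<lambda>r. \<alpha> r + \<alpha>' r)"
    using assms
    by (intro strict_mono_onI add_strict_mono) (simp_all add: class_K_def strict_mono_on_def)
  ultimately show ?thesis
    using assms unfolding class_K_def by simp
qed

lemma class_K_compose:
  assumes "class_K \<alpha>" "class_K \<alpha>'"
  shows "class_K (\<lambda>r. \<alpha> (\<alpha>' r))"
proof -
  have "continuous_on {0..} \<alpha>'" "\<alpha>' ` {0..} \<subseteq> {0..}" "continuous_on {0..} \<alpha>"
    using assms by (simp_all add: class_K_def image_subset_iff)
  then have "continuous_on {0..} (\<lambda>r. \<alpha> (\<alpha>' r))"
    by (metis continuous_on_compose2)
  then show ?thesis
    using assms unfolding class_K_def strict_mono_on_def by simp
qed

text \<open>This is continuity of \<open>\<alpha>\<close> at 0 relative to \<open>{0..}\<close>.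
  Nothing is known of \<open>\<alpha>\<close> at negative arguments, hence the condition on the sign
  of \<open>u\<close>.\<close>

lemma class_K_tendsto_zero:
  assumes "class_K \<alpha>" "(u \<longlongrightarrow> 0) F" "\<forall>\<^sub>F t in F. 0 \<le> u t"
  shows "((\<lambda>t. \<alpha> (u t)) \<longlongrightarrow> 0) F"
proof -
  have "continuous_on {0..} \<alpha>" "\<alpha> 0 = 0"
    using assms(1) unfolding class_K_def by simp_all
  then show ?thesis
    using continuous_on_tendsto_compose[of "{0..}" \<alpha> u 0 F] assms(2,3) by simp
qed

section \<open>Comparison functions of class \<open>KL\<close>\<close>

lemma class_KL_class_K: "class_KL \<beta> \<Longrightarrow> 0 \<le> t \<Longrightarrow> class_K (\<lambda>r. \<beta> r t)"
  by (simp add: class_KL_def)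

lemma class_KL_nonneg: "class_KL \<beta> \<Longrightarrow> 0 \<le> r \<Longrightarrow> 0 \<le> t \<Longrightarrow> 0 \<le> \<beta> r t"
  using class_K_nonneg[OF class_KL_class_K] .

lemma class_KL_antimono: "class_KL \<beta> \<Longrightarrow> 0 \<le> r \<Longrightarrow> 0 \<le> s \<Longrightarrow> s \<le> t \<Longrightarrow> \<beta> r t \<le> \<beta> r s"
  unfolding class_KL_def by (meson atLeast_iff monotone_onD order_trans)

lemma class_KL_tendsto_zero: "class_KL \<beta> \<Longrightarrow> 0 \<le> r \<Longrightarrow> (\<beta> r \<longlongrightarrow> 0) at_top"
  by (simp add: class_KL_def)

lemma class_KL_le:
  assumes "class_KL \<beta>" "0 \<le> r" "r \<le> r'" "0 \<le> t'" "t' \<le> t"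
  shows "\<beta> r t \<le> \<beta> r' t'"
proof -
  have "\<beta> r t \<le> \<beta> r t'"
    using assms by (simp add: class_KL_antimono)
  also have "\<dots> \<le> \<beta> r' t'"
    using class_K_mono[OF class_KL_class_K[OF assms(1,4)] assms(2,3)] .
  finally show ?thesis .
qed

lemma class_KL_continuous_on:
  "class_KL \<beta> \<Longrightarrow> continuous_on ({0..} \<times> {0..}) (\<lambda>p. \<beta> (fst p) (snd p))"
  by (simp add: class_KL_def split_def)

lemma class_KL_I:
  assumes "continuous_on ({0..} \<times> {0..}) (\<lambda>p. \<beta> (fst p) (snd p))"
    and "\<And>t. 0 \<le> t \<Longrightarrow> class_K (\<lambda>r. \<beta> r t)"
    and "\<And>r s t. 0 \<le> r \<Longrightarrow> 0 \<le> s \<Longrightarrow> s \<le> t \<Longrightarrow> \<beta> r t \<le> \<beta> r s"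
    and "\<And>r. 0 \<le> r \<Longrightarrow> (\<beta> r \<longlongrightarrow> 0) at_top"
  shows "class_KL \<beta>"
  unfolding class_KL_def split_def monotone_on_def using assms by simp

lemma class_KL_add:
  assumes "class_KL \<beta>" "class_KL \<beta>'"
  shows "class_KL (\<lambda>r t. \<beta> r t + \<beta>' r t)"
proof (rule class_KL_I)
  show "continuous_on ({0..} \<times> {0..}) (\<lambda>p. \<beta> (fst p) (snd p) + \<beta>' (fst p) (snd p))"
    by (intro continuous_on_add class_KL_continuous_on assms)
  show "class_K (\<lambda>r. \<beta> r t + \<beta>' r t)" if "0 \<le> t" for t
    using assms[THEN class_KL_class_K, OF that] by (rule class_K_add)
  show "\<beta> r t + \<beta>' r t \<le> \<beta> r s + \<beta>' r s" if "0 \<le> r" "0 \<le> s" "s \<le> t" for r s t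
    using assms[THEN class_KL_antimono, OF that] by (rule add_mono)
  show "((\<lambda>t. \<beta> r t + \<beta>' r t) \<longlongrightarrow> 0) at_top" if "0 \<le> r" for r
    using assms[THEN class_KL_tendsto_zero, OF that] by (rule tendsto_add_zero)
qed

lemma class_KL_compose_class_K:
  assumes \<gamma>: "class_K \<gamma>" and \<beta>: "class_KL \<beta>"
  shows "class_KL (\<lambda>r t. \<gamma> (\<beta> r t))"
proof (rule class_KL_I)
  have "continuous_on {0..} \<gamma>"
    using \<gamma> by (simp add: class_K_def)
  then show "continuous_on ({0..} \<times> {0..}) (\<lambda>p. \<gamma> (\<beta> (fst p) (snd p)))"
    by (rule continuous_on_compose2[OF _ class_KL_continuous_on[OF \<beta>]])
      (use class_KL_nonneg[OF \<beta>] in force)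
  show "class_K (\<lambda>r. \<gamma> (\<beta> r t))" if "0 \<le> t" for t
    using class_K_compose[OF \<gamma> class_KL_class_K[OF \<beta> that]] .
  show "\<gamma> (\<beta> r t) \<le> \<gamma> (\<beta> r s)" if "0 \<le> r" "0 \<le> s" "s \<le> t" for r s t
    using that
    by (intro class_K_mono[OF \<gamma>] class_KL_antimono[OF \<beta>] class_KL_nonneg[OF \<beta>]) simp_all
  show "((\<lambda>t. \<gamma> (\<beta> r t)) \<longlongrightarrow> 0) at_top" if "0 \<le> r" for r
  proof (rule class_K_tendsto_zero[OF \<gamma> class_KL_tendsto_zero[OF \<beta> that]])
    \<comment> \<open>The sign of \<open>\<beta> r t\<close> is known only for nonnegative times, so
      it is claimed only eventually.\<close>
    show "\<forall>\<^sub>F t in at_top. 0 \<le> \<beta> r t"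
      using eventually_ge_at_top[of 0] by eventually_elim (rule class_KL_nonneg[OF \<beta> that])
  qed
qed

text \<open>Decay survives the change of clock because \<open>m\<close> tends to infinity, and joint
  continuity because \<open>m\<close> is continuous. The latter rules out a step function such as a
  rounded half of \<open>t\<close>.\<close>

lemma class_KL_reparametrize:
  assumes \<beta>: "class_KL \<beta>" and \<rho>: "class_K \<rho>"
    and m: "continuous_on {0..} m" "mono_on {0..} m" "\<And>t. 0 \<le> t \<Longrightarrow> 0 \<le> m t"
      "filterlim m at_top at_top"
  shows "class_KL (\<lambda>r t. \<beta> (\<rho> r) (m t))"
proof (rule class_KL_I)
  have \<rho>_cont: "continuous_on {0..} \<rho>"
    using \<rho> by (simp add: class_K_def)
  have "continuous_on ({0..} \<times> {0..}) (\<lambda>p. \<rho> (fst p))"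
    by (rule continuous_on_compose2[OF \<rho>_cont continuous_on_fst[OF continuous_on_id]]) force
  moreover have "continuous_on ({0..} \<times> {0..}) (\<lambda>p. m (snd p))"
    by (rule continuous_on_compose2[OF m(1) continuous_on_snd[OF continuous_on_id]]) force
  ultimately have "continuous_on ({0..} \<times> {0..}) (\<lambda>p. (\<rho> (fst p), m (snd p)))"
    by (rule continuous_on_Pair)
  from continuous_on_compose2[OF class_KL_continuous_on[OF \<beta>] this]
  show "continuous_on ({0..} \<times> {0..}) (\<lambda>p. \<beta> (\<rho> (fst p)) (m (snd p)))"
    using class_K_nonneg[OF \<rho>] m(3) by force
  show "class_K (\<lambda>r. \<beta> (\<rho> r) (m t))" if "0 \<le> t" for t
    using class_K_compose[OF class_KL_class_K[OF \<beta> m(3)[OF that]] \<rho>] .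
  show "\<beta> (\<rho> r) (m t) \<le> \<beta> (\<rho> r) (m s)" if "0 \<le> r" "0 \<le> s" "s \<le> t" for r s t
    using that
    by (intro class_KL_antimono[OF \<beta>] class_K_nonneg[OF \<rho>] m(3) mono_onD[OF m(2)]) simp_all
  show "((\<lambda>t. \<beta> (\<rho> r) (m t)) \<longlongrightarrow> 0) at_top" if "0 \<le> r" for r
    using filterlim_compose[OF class_KL_tendsto_zero[OF \<beta> class_K_nonneg[OF \<rho> that]] m(4)] .
qed

section \<open>Stability from a \<open>KL\<close> bound\<close>

text \<open>The value of the bound at time 0 dominates all later ones and is continuous in the
  initial norm, with value 0 at 0; this gives stability. Its decay in time gives
  convergence.\<close>

lemma globally_asymptotically_stable_if_class_KL_bound:
  assumes \<beta>: "class_KL \<beta>"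
    and bound: "\<And>\<zeta> t. \<zeta> \<in> Z \<Longrightarrow> norm ((F ^^ t) \<zeta>) \<le> \<beta> (norm \<zeta>) (real t)"
  shows "globally_asymptotically_stable Z F"
  unfolding globally_asymptotically_stable_def
proof (intro conjI allI impI ballI)
  fix \<epsilon> :: real
  assume "0 < \<epsilon>"
  have cont: "continuous_on {0..} (\<lambda>r. \<beta> r 0)" and zero: "\<beta> 0 0 = 0"
    using class_KL_class_K[OF \<beta>, of 0] unfolding class_K_def by simp_all
  obtain \<delta> where "0 < \<delta>"
    and \<delta>: "\<And>r. r \<in> {0..} \<Longrightarrow> dist r 0 < \<delta> \<Longrightarrow> dist (\<beta> r 0) (\<beta> 0 0) < \<epsilon>"
    using cont[unfolded continuous_on_iff, rule_format, of 0 \<epsilon>] \<open>0 < \<epsilon>\<close> by force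
  have "norm ((F ^^ t) \<zeta>) < \<epsilon>" if "\<zeta> \<in> Z" "norm \<zeta> < \<delta>" for \<zeta> t
  proof -
    have "norm ((F ^^ t) \<zeta>) \<le> \<beta> (norm \<zeta>) (real t)"
      using bound that by blast
    also have "\<dots> \<le> \<beta> (norm \<zeta>) 0"
      by (rule class_KL_antimono[OF \<beta>]) simp_all
    also have "\<dots> < \<epsilon>"
      using \<delta>[of "norm \<zeta>"] \<open>norm \<zeta> < \<delta>\<close> by (simp add: zero)
    finally show ?thesis .
  qed
  with \<open>0 < \<delta>\<close> show "\<exists>\<delta>>0. \<forall>\<zeta>\<in>Z. norm \<zeta> < \<delta> \<longrightarrow> (\<forall>t. norm ((F ^^ t) \<zeta>) < \<epsilon>)"
    by blast
next
  fix \<zeta>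
  assume "\<zeta> \<in> Z"
  have "(\<lambda>t. \<beta> (norm \<zeta>) (real t)) \<longlonglongrightarrow> 0"
    by (rule filterlim_compose[OF class_KL_tendsto_zero[OF \<beta> norm_ge_zero]
          filterlim_real_sequentially])
  then show "(\<lambda>t. (F ^^ t) \<zeta>) \<longlonglongrightarrow> 0"
    by (rule Lim_null_comparison[OF always_eventually[OF allI[OF bound[OF \<open>\<zeta> \<in> Z\<close>]]]])
next
  show "\<exists>\<beta>. class_KL \<beta> \<and> (\<forall>\<zeta>\<in>Z. \<forall>t. norm ((F ^^ t) \<zeta>) \<le> \<beta> (norm \<zeta>) (real t))"
    using assms by blast
qed

section \<open>Trajectories of systems with input and of cascades\<close>

text \<open>This makes the restart possible: the later error is again a solution, driven by the tail
  of the input.\<close>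

lemma input_solution_add:
  "input_solution G \<eta> x (s + t) = input_solution G (input_solution G \<eta> x s) (\<lambda>\<tau>. x (s + \<tau>)) t"
  by (induction t) auto

lemma input_solution_in:
  assumes "\<eta> \<in> E" "range x \<subseteq> X" "\<And>e x. e \<in> E \<Longrightarrow> x \<in> X \<Longrightarrow> G e x \<in> E"
  shows "input_solution G \<eta> x t \<in> E"
  using assms by (induction t) auto

text \<open>The first component evolves on its own, so the second sees its orbit as a prescribed
  input.\<close>

lemma cascade_funpow:
  "(cascade F G ^^ t) (\<xi>, \<eta>) = ((F ^^ t) \<xi>, input_solution G \<eta> (\<lambda>s. (F ^^ s) \<xi>) t)"
  by (induction t) (auto simp: cascade_def)

text \<open>The network theorem is the instance \<open>F = f\<close>, \<open>G = g\<close>.\<close>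

lemma globally_asymptotically_stable_cascade:
  fixes X :: "'x::real_normed_vector set" and E :: "'e::real_normed_vector set"
  assumes F: "\<And>x. x \<in> X \<Longrightarrow> F x \<in> X"
    and G: "\<And>e x. e \<in> E \<Longrightarrow> x \<in> X \<Longrightarrow> G e x \<in> E"
    and ISS: "input_to_state_stable E X G"
    and GAS: "globally_asymptotically_stable X F"
  shows "globally_asymptotically_stable (X \<times> E) (cascade F G)"
proof -
  from GAS obtain \<beta>x where \<beta>x: "class_KL \<beta>x"
    and x_bound: "\<And>\<xi> t. \<xi> \<in> X \<Longrightarrow> norm ((F ^^ t) \<xi>) \<le> \<beta>x (norm \<xi>) (real t)"
    unfolding globally_asymptotically_stable_def by blast
  from ISS obtain \<beta>e \<gamma> where \<beta>e: "class_KL \<beta>e" and \<gamma>: "class_K \<gamma>"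
    and e_bound: "\<And>\<eta> x t. \<eta> \<in> E \<Longrightarrow> range x \<subseteq> X \<Longrightarrow> bounded (range x) \<Longrightarrow>
      norm (input_solution G \<eta> x t) \<le> \<beta>e (norm \<eta>) (real t) + \<gamma> (SUP s. norm (x s))"
    unfolding input_to_state_stable_def by blast
  define \<rho> where "\<rho> = (\<lambda>r. \<beta>e r 0 + \<gamma> (\<beta>x r 0))"
  \<comment> \<open>A continuous lower bound for both \<open>t div 2\<close> and \<open>t - t div 2\<close>.\<close>
  define m :: "real \<Rightarrow> real" where "m = (\<lambda>t. max 0 ((t - 1) / 2))"
  \<comment> \<open>The first summand bounds the state and the other two the error after the
    restart; all are evaluated at the joint norm of the initial pair.\<close>
  define \<beta> where "\<beta> = (\<lambda>r t. \<beta>x r (m t) + (\<beta>e (\<rho> r) (m t) + \<gamma> (\<beta>x r (m t))))"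
  have \<rho>: "class_K \<rho>"
    unfolding \<rho>_def
    using class_K_add[OF class_KL_class_K[OF \<beta>e] class_K_compose[OF \<gamma> class_KL_class_K[OF \<beta>x]]]
    by simp
  \<comment> \<open>With the identity in place of \<open>\<rho>\<close>, reparametrization changes
    only the clock of \<open>\<beta>x\<close>.\<close>
  have id: "class_K (\<lambda>r. r)"
    unfolding class_K_def strict_mono_on_def by (simp add: continuous_on_id)
  have m: "continuous_on {0..} m" "mono_on {0..} m" "\<And>t. 0 \<le> t \<Longrightarrow> 0 \<le> m t"
  proof -
    show "continuous_on {0..} m"
      unfolding m_def by (intro continuous_intros) simp
    show "mono_on {0..} m"
      unfolding m_def by (intro mono_onI max.mono divide_right_mono) simp_all
    show "0 \<le> m t" if "0 \<le> t" for t
      by (simp add: m_def)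
  qed
  have m_lim: "filterlim m at_top at_top"
  proof (rule filterlim_at_top_mono)
    \<comment> \<open>The affine branch of the maximum is a lower bound, written in the shape that
      the product and sum rules for divergence expect.\<close>
    show "filterlim (\<lambda>t::real. (1 / 2) * (- 1 + t)) at_top at_top"
      by (intro filterlim_tendsto_pos_mult_at_top[OF tendsto_const]
            filterlim_tendsto_add_at_top[OF tendsto_const] filterlim_ident) auto
  qed (auto simp: m_def)
  have \<beta>x': "class_KL (\<lambda>r t. \<beta>x r (m t))"
    using class_KL_reparametrize[OF \<beta>x id m m_lim] .
  have \<beta>: "class_KL \<beta>"
    unfolding \<beta>_def
    using class_KL_add[OF \<beta>x' class_KL_add[OF class_KL_reparametrize[OF \<beta>e \<rho> m m_lim]
            class_KL_compose_class_K[OF \<gamma> \<beta>x']]] .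
  have in_X: "(F ^^ t) \<xi> \<in> X" if "\<xi> \<in> X" for \<xi> t
    by (induction t) (simp_all add: F that)
  \<comment> \<open>Used twice: with \<open>s = 0\<close> to bound the error at half time, and with
    \<open>s = t div 2\<close> for the remaining steps.\<close>
  have restart: "norm (input_solution G \<eta> (\<lambda>\<tau>. (F ^^ (s + \<tau>)) \<xi>) t)
      \<le> \<beta>e (norm \<eta>) (real t) + \<gamma> (\<beta>x (norm \<xi>) (real s))"
    if "\<eta> \<in> E" "\<xi> \<in> X" for \<eta> \<xi> s t
  proof -
    let ?x = "\<lambda>\<tau>. (F ^^ (s + \<tau>)) \<xi>"
    have le: "norm (?x \<tau>) \<le> \<beta>x (norm \<xi>) (real s)" for \<tau>
      by (rule order_trans[OF x_bound[OF \<open>\<xi> \<in> X\<close>] class_KL_antimono[OF \<beta>x]]) simp_all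
    then have bdd: "bounded (range ?x)"
      unfolding bounded_iff by blast
    \<comment> \<open>\<open>\<gamma>\<close> is monotone only on \<open>{0..}\<close>, so the
      supremum must first be shown nonnegative; it dominates the norm of one term.\<close>
    have "norm (?x 0) \<le> (SUP \<tau>. norm (?x \<tau>))"
      by (rule cSUP_upper[OF UNIV_I bdd_aboveI2]) (rule le)
    then have "0 \<le> (SUP \<tau>. norm (?x \<tau>))"
      using norm_ge_zero order_trans by blast
    moreover have "(SUP \<tau>. norm (?x \<tau>)) \<le> \<beta>x (norm \<xi>) (real s)"
      by (rule cSUP_least) (simp_all add: le)
    ultimately have "\<gamma> (SUP \<tau>. norm (?x \<tau>)) \<le> \<gamma> (\<beta>x (norm \<xi>) (real s))"
      by (rule class_K_mono[OF \<gamma>])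
    moreover have "range ?x \<subseteq> X"
      using in_X[OF \<open>\<xi> \<in> X\<close>] by blast
    ultimately show ?thesis
      using e_bound[OF \<open>\<eta> \<in> E\<close> _ bdd, of t] by linarith
  qed
  have "norm ((cascade F G ^^ t) (\<xi>, \<eta>)) \<le> \<beta> (norm (\<xi>, \<eta>)) (real t)"
    if "\<xi> \<in> X" "\<eta> \<in> E" for \<xi> \<eta> t
  proof -
    let ?r = "norm (\<xi>, \<eta>)" and ?s = "t div 2"
    let ?x = "\<lambda>s. (F ^^ s) \<xi>"
    let ?e = "input_solution G \<eta> ?x"
    have r: "norm \<xi> \<le> ?r" "norm \<eta> \<le> ?r"
      using norm_fst_le[of \<xi> \<eta>] norm_snd_le[of \<eta> \<xi>] by auto
    have "range ?x \<subseteq> X"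
      using in_X[OF \<open>\<xi> \<in> X\<close>] by blast
    \<comment> \<open>The input-to-state bound applies only to initial errors in \<open>E\<close>,
      so the restart state must lie there.\<close>
    then have e_in: "?e ?s \<in> E"
      by (rule input_solution_in[OF \<open>\<eta> \<in> E\<close> _ G])
    have m_le: "m (real t) \<le> real ?s" "m (real t) \<le> real (t - ?s)" "m (real t) \<le> real t"
      and m_ge: "0 \<le> m (real t)"
    proof -
      \<comment> \<open>For odd \<open>t\<close> the half \<open>t div 2\<close> is exactly
        \<open>(t - 1) / 2\<close>, whence the shift by one in \<open>m\<close>.\<close>
      have "t \<le> 2 * ?s + 1" "t \<le> 2 * (t - ?s) + 1" "?s \<le> t"
        by simp_all
      then have "real t - 1 \<le> 2 * real ?s" "real t - 1 \<le> 2 * real (t - ?s)"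
        by linarith+
      then show "m (real t) \<le> real ?s" "m (real t) \<le> real (t - ?s)" "m (real t) \<le> real t"
        "0 \<le> m (real t)"
        by (simp_all add: m_def)
    qed
    \<comment> \<open>Needed at \<open>u = s = 0\<close> for the half-time error and at
      \<open>u = m (real t)\<close>, \<open>s = t div 2\<close> for the final bound.\<close>
    have \<gamma>x: "\<gamma> (\<beta>x (norm \<xi>) s) \<le> \<gamma> (\<beta>x ?r u)" if "0 \<le> u" "u \<le> s" for s u
      using that r(1)
      by (intro class_K_mono[OF \<gamma>] class_KL_le[OF \<beta>x] class_KL_nonneg[OF \<beta>x]) simp_all
    have "norm (?e ?s) \<le> \<beta>e (norm \<eta>) (real ?s) + \<gamma> (\<beta>x (norm \<xi>) 0)"
      using restart[OF \<open>\<eta> \<in> E\<close> \<open>\<xi> \<in> X\<close>, of 0 ?s] by simp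
    \<comment> \<open>The decay over the first half is discarded by moving both time arguments to 0;
      only boundedness of the restart state matters.\<close>
    also have "\<dots> \<le> \<rho> ?r"
      unfolding \<rho>_def by (rule add_mono[OF class_KL_le[OF \<beta>e _ r(2)] \<gamma>x]) simp_all
    finally have e_mid: "norm (?e ?s) \<le> \<rho> ?r" .
    have "?e t = input_solution G (?e ?s) (\<lambda>\<tau>. (F ^^ (?s + \<tau>)) \<xi>) (t - ?s)"
      using input_solution_add[of G \<eta> ?x ?s "t - ?s"] by simp
    then have "norm (?e t) \<le> \<beta>e (norm (?e ?s)) (real (t - ?s)) + \<gamma> (\<beta>x (norm \<xi>) (real ?s))"
      by (simp only: restart[OF e_in \<open>\<xi> \<in> X\<close>])
    also have "\<dots> \<le> \<beta>e (\<rho> ?r) (m (real t)) + \<gamma> (\<beta>x ?r (m (real t)))"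
      by (rule add_mono[OF class_KL_le[OF \<beta>e norm_ge_zero e_mid m_ge m_le(2)]
            \<gamma>x[OF m_ge m_le(1)]])
    finally have "norm (?e t) \<le> \<dots>" .
    moreover have "norm (?x t) \<le> \<beta>x ?r (m (real t))"
      using x_bound[OF \<open>\<xi> \<in> X\<close>] class_KL_le[OF \<beta>x norm_ge_zero r(1) m_ge m_le(3)]
      by (rule order_trans)
    ultimately show ?thesis
      unfolding cascade_funpow \<beta>_def using norm_Pair_le[of "?x t" "?e t"] by linarith
  qed
  then show ?thesis
    by (intro globally_asymptotically_stable_if_class_KL_bound[OF \<beta>]) auto
qed

theorem mainTheorem1:
  fixes X E :: "(real ^ 'n) set" and Y :: "(real ^ 'm) set"
    and f :: "real ^ 'n \<Rightarrow> real ^ 'n" and h :: "real ^ 'n \<Rightarrow> real ^ 'm"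
    and W\<^sub>a\<^sub>y :: "real ^ 'm ^ 'k" and W\<^sub>a\<^sub>x :: "real ^ 'n ^ 'k" and W\<^sub>x\<^sub>a :: "real ^ 'k ^ 'n"
    and \<sigma> :: "real \<Rightarrow> real" and r :: nat
    and g :: "real ^ 'n \<Rightarrow> real ^ 'n \<Rightarrow> real ^ 'n"
  defines "g \<equiv> error_map f h W\<^sub>a\<^sub>y W\<^sub>a\<^sub>x W\<^sub>x\<^sub>a \<sigma>"
  assumes "0 \<in> X" and "0 \<in> E"
    and "f ` X \<subseteq> X" and "h ` X \<subseteq> Y"
    and "Cr_on r X f" and "Cr_on r X h"
    and "\<forall>e\<in>E. \<forall>x\<in>X. g e x \<in> E"
    and "input_to_state_stable E X g"
    and "globally_asymptotically_stable X f"
  shows "globally_asymptotically_stable (X \<times> E) (cascade f g)"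
  using assms by (intro globally_asymptotically_stable_cascade) auto

end
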